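(* Let $\Omega\subset\mathbb{H}$ be a symmetric slice domain and let $f=f_{0}+f_{v}\in \mathcal{S}(\Omega)$ be a function which preserves no slice and has $f_0\not\equiv0$. Let $d>2$ be an integer. Then $f^{*d}$ is slice preserving if and only if there exists $\xi\in\Sigma_d$ such that $f_{0}^{2}\equiv \xi^2 f_{v}^{s}$, that is, $f_{0}$ is a square root of $\xi^2 f_{v}^{s}$.
   Context: $\mathbb{H}$ is the algebra of quaternions with standard basis $1,i,j,k$, $\mathbb{S}=\{q\in\mathbb{H}: q^2=-1\}$, and $\mathbb{C}_I=\mathrm{Span}_{\mathbb{R}}(1,I)$ for $I\in\mathbb{S}$. A symmetric slice domain $\Omega\subset\mathbb{H}$ is a domain (connected open set) such that $\Omega\cap\mathbb{R}\neq\emptyset$ and, whenever $\alpha+I\beta\in\Omega$ ($\alpha,\beta\in\mathbb{R}$, $I\in\mathbb{S}$), also $\alpha+J\beta\in\Omega$ for all $J\in\mathbb{S}$. A function $f:\Omega\to\mathbb{H}$ is slice regular if for every $J\in\mathbb{S}$ the restriction $f_J$ of $f$ to $\Omega\cap\mathbb{C}_J$ is holomorphic: $\frac12\left(\frac{\partial}{\partial\alpha}+J\frac{\partial}{\partial\beta}\right)f_J(\alpha+J\beta)\equiv0$. $\mathcal{S}(\Omega)$ is the set of slice regular functions on $\Omega$; $f\in\mathcal{S}(\Omega)$ is slice preserving ($f\in\mathcal{S}_{\mathbb{R}}(\Omega)$) if $f(\Omega\cap\mathbb{C}_I)\subset\mathbb{C}_I$ for all $I\in\mathbb{S}$, and preserves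 no slice if $f(\Omega\cap\mathbb{C}_J)\not\subset\mathbb{C}_J$ for every $J\in\mathbb{S}$. Known fact: every $f\in\mathcal{S}(\Omega)$ is written uniquely as $f=f_0+f_1i+f_2j+f_3k$ with $f_0,\dots,f_3\in\mathcal{S}_{\mathbb{R}}(\Omega)$; $f_0$ is its real part, $f_v=f_1i+f_2j+f_3k$ its vectorial part, and $f_v^s=f_1^2+f_2^2+f_3^2\in\mathcal{S}_{\mathbb{R}}(\Omega)$. The $*$-product is $f*g=f_0g_0-f_1g_1-f_2g_2-f_3g_3+f_0(g_1i+g_2j+g_3k)+g_0(f_1i+f_2j+f_3k)+(f_2g_3-f_3g_2)i+(f_3g_1-f_1g_3)j+(f_1g_2-f_2g_1)k$ (pointwise products); it is associative, and $f^{*d}$ is the $d$-fold $*$-product of $f$ with itself. For an integer $d>2$, $$Q_d(x,y)=\sum_{n=0}^{[(d-1)/2]}(-1)^n\binom{d}{2n+1}x^{d-(2n+1)}y^{2n+1},$$ and $\Sigma_d\subset\mathbb{P}(\mathbb{R}^2)\simeq\mathbb{R}\cup\{\infty\}$ (with $[x:y]\leftrightarrow x/y$, $0=[0:1]$, $\infty=[1:0]$) is the set of roots of $Q_d$ different from $0$ and $\infty$; i.e. $\Sigma_d=\{\xi\in\mathbb{R}\setminus\{0\}: Q_d(\xi,1)=0\}$. *)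

theory Defs
  imports "HOL-Analysis.Analysis"
begin

section \<open>Quaternions\<close>

text \<open>The development follows the one of the complex numbers in \<^theory>\<open>HOL.Complex\<close>.\<close>

codatatype quat = Quat (qRe: real) (qIm1: real) (qIm2: real) (qIm3: real)

lemma quat_eqI: "\<lbrakk>qRe x = qRe y; qIm1 x = qIm1 y; qIm2 x = qIm2 y; qIm3 x = qIm3 y\<rbrakk> \<Longrightarrow> x = y"
  by (rule quat.expand) simp

lemma quat_eq_iff:
  "x = y \<longleftrightarrow> qRe x = qRe y \<and> qIm1 x = qIm1 y \<and> qIm2 x = qIm2 y \<and> qIm3 x = qIm3 y"
  by (auto intro: quat_eqI)

instantiation quat :: ab_group_add
begin

primcorec zero_quat where
  "qRe 0 = 0"
| "qIm1 0 = 0"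
| "qIm2 0 = 0"
| "qIm3 0 = 0"

primcorec plus_quat where
  "qRe (x + y) = qRe x + qRe y"
| "qIm1 (x + y) = qIm1 x + qIm1 y"
| "qIm2 (x + y) = qIm2 x + qIm2 y"
| "qIm3 (x + y) = qIm3 x + qIm3 y"

primcorec uminus_quat where
  "qRe (- x) = - qRe x"
| "qIm1 (- x) = - qIm1 x"
| "qIm2 (- x) = - qIm2 x"
| "qIm3 (- x) = - qIm3 x"

primcorec minus_quat where
  "qRe (x - y) = qRe x - qRe y"
| "qIm1 (x - y) = qIm1 x - qIm1 y"
| "qIm2 (x - y) = qIm2 x - qIm2 y"
| "qIm3 (x - y) = qIm3 x - qIm3 y"

instance by standard (simp_all add: quat_eq_iff)

end

instantiation quat :: real_algebra_1
begin

primcorec one_quat where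
  "qRe 1 = 1"
| "qIm1 1 = 0"
| "qIm2 1 = 0"
| "qIm3 1 = 0"

primcorec times_quat where
  "qRe (x * y) = qRe x * qRe y - qIm1 x * qIm1 y - qIm2 x * qIm2 y - qIm3 x * qIm3 y"
| "qIm1 (x * y) = qRe x * qIm1 y + qIm1 x * qRe y + qIm2 x * qIm3 y - qIm3 x * qIm2 y"
| "qIm2 (x * y) = qRe x * qIm2 y - qIm1 x * qIm3 y + qIm2 x * qRe y + qIm3 x * qIm1 y"
| "qIm3 (x * y) = qRe x * qIm3 y + qIm1 x * qIm2 y - qIm2 x * qIm1 y + qIm3 x * qRe y"

primcorec scaleR_quat where
  "qRe (r *\<^sub>R x) = r * qRe x"
| "qIm1 (r *\<^sub>R x) = r * qIm1 x"
| "qIm2 (r *\<^sub>R x) = r * qIm2 x"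
| "qIm3 (r *\<^sub>R x) = r * qIm3 x"

instance by standard (simp_all add: quat_eq_iff algebra_simps)

end

instantiation quat :: real_div_algebra
begin

primcorec inverse_quat where
  "qRe (inverse x) = qRe x / ((qRe x)\<^sup>2 + (qIm1 x)\<^sup>2 + (qIm2 x)\<^sup>2 + (qIm3 x)\<^sup>2)"
| "qIm1 (inverse x) = - qIm1 x / ((qRe x)\<^sup>2 + (qIm1 x)\<^sup>2 + (qIm2 x)\<^sup>2 + (qIm3 x)\<^sup>2)"
| "qIm2 (inverse x) = - qIm2 x / ((qRe x)\<^sup>2 + (qIm1 x)\<^sup>2 + (qIm2 x)\<^sup>2 + (qIm3 x)\<^sup>2)"
| "qIm3 (inverse x) = - qIm3 x / ((qRe x)\<^sup>2 + (qIm1 x)\<^sup>2 + (qIm2 x)\<^sup>2 + (qIm3 x)\<^sup>2)"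

definition "x div y = x * inverse y" for x y :: quat

instance
proof
  fix x y :: quat
  define N where "N = (qRe x)\<^sup>2 + (qIm1 x)\<^sup>2 + (qIm2 x)\<^sup>2 + (qIm3 x)\<^sup>2"
  have inv: "inverse x = (1 / N) *\<^sub>R Quat (qRe x) (- qIm1 x) (- qIm2 x) (- qIm3 x)"
    by (rule quat_eqI) (simp_all add: N_def)
  have l: "Quat (qRe x) (- qIm1 x) (- qIm2 x) (- qIm3 x) * x = N *\<^sub>R 1"
    by (rule quat_eqI) (simp_all add: N_def power2_eq_square)
  have r: "x * Quat (qRe x) (- qIm1 x) (- qIm2 x) (- qIm3 x) = N *\<^sub>R 1"
    by (rule quat_eqI) (simp_all add: N_def power2_eq_square)
  have N: "N \<noteq> 0" if "x \<noteq> 0"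
    using that unfolding N_def quat_eq_iff by (auto simp: add_nonneg_eq_0_iff)
  show "inverse x * x = 1" if "x \<noteq> 0"
    using N[OF that] by (simp only: inv mult_scaleR_left l) simp
  show "x * inverse x = 1" if "x \<noteq> 0"
    using N[OF that] by (simp only: inv mult_scaleR_right r) simp
  show "x div y = x * inverse y" by (rule divide_quat_def)
  show "inverse (0::quat) = 0" by (simp add: quat_eq_iff)
qed

end

instantiation quat :: real_inner
begin

definition "inner x y = qRe x * qRe y + qIm1 x * qIm1 y + qIm2 x * qIm2 y + qIm3 x * qIm3 y"

definition "norm x = sqrt ((qRe x)\<^sup>2 + (qIm1 x)\<^sup>2 + (qIm2 x)\<^sup>2 + (qIm3 x)\<^sup>2)" for x :: quat

definition sgn_quat_def: "sgn x = x /\<^sub>R norm x" for x :: quat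

definition dist_quat_def: "dist x y = norm (x - y)" for x y :: quat

definition uniformity_quat_def [code del]:
  "(uniformity :: (quat \<times> quat) filter) = (INF e\<in>{0 <..}. principal {(x, y). dist x y < e})"

definition open_quat_def [code del]:
  "open (U :: quat set) \<longleftrightarrow> (\<forall>x\<in>U. eventually (\<lambda>(x', y). x' = x \<longrightarrow> y \<in> U) uniformity)"

instance
proof
  fix x y z :: quat and r :: real
  show "inner x x = 0 \<longleftrightarrow> x = 0"
    by (simp add: inner_quat_def quat_eq_iff add_nonneg_eq_0_iff power2_eq_square[symmetric])
  show "norm x = sqrt (inner x x)"
    by (simp add: inner_quat_def norm_quat_def power2_eq_square)
qed (simp_all add: inner_quat_def algebra_simps sgn_quat_def dist_quat_def
       open_quat_def uniformity_quat_def)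

end

instance quat :: real_normed_div_algebra
proof
  fix x y :: quat
  define conj where "conj z = Quat (qRe z) (- qIm1 z) (- qIm2 z) (- qIm3 z)" for z
  have conj: "z * conj z = (norm z)\<^sup>2 *\<^sub>R 1" for z
    by (rule quat_eqI) (simp_all add: conj_def norm_quat_def power2_eq_square)
  have conj_mult: "conj (x * y) = conj y * conj x"
    by (rule quat_eqI) (simp_all add: conj_def)
  have "(norm (x * y))\<^sup>2 *\<^sub>R (1 :: quat) = x * (y * conj y) * conj x"
    unfolding conj[symmetric] conj_mult by (simp only: mult.assoc)
  also have "\<dots> = ((norm x)\<^sup>2 * (norm y)\<^sup>2) *\<^sub>R 1"
    unfolding conj by (simp add: conj mult.commute)
  finally have "(norm (x * y))\<^sup>2 = (norm x * norm y)\<^sup>2"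
    by (simp add: power_mult_distrib)
  then show "norm (x * y) = norm x * norm y"
    by (rule power2_eq_imp_eq) simp_all
qed

definition quat_i :: quat where "quat_i = Quat 0 1 0 0"
definition quat_j :: quat where "quat_j = Quat 0 0 1 0"
definition quat_k :: quat where "quat_k = Quat 0 0 0 1"

instantiation quat :: euclidean_space
begin

definition Basis_quat_def: "Basis = {1, quat_i, quat_j, quat_k}"

instance
proof
  fix u v x :: quat
  show "inner u v = (if u = v then 1 else 0)" if "u \<in> Basis" "v \<in> Basis"
    using that unfolding Basis_quat_def
    by (elim insertE emptyE; hypsubst; simp add: inner_quat_def quat_eq_iff quat_i_def quat_j_def quat_k_def)
  show "(\<forall>u\<in>Basis. inner x u = 0) \<longleftrightarrow> x = 0"
    unfolding Basis_quat_def ball_simps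
    by (simp add: inner_quat_def quat_eq_iff quat_i_def quat_j_def quat_k_def)
qed (simp_all add: Basis_quat_def)

end


section \<open>Slice regular functions\<close>

definition imag_units :: "quat set" where
  "imag_units = {q. q\<^sup>2 = -1}"

definition slice :: "quat \<Rightarrow> quat set" where
  "slice I = span {1, I}"

definition symmetric_slice_domain :: "quat set \<Rightarrow> bool" where
  "symmetric_slice_domain \<Omega> \<longleftrightarrow>
     open \<Omega> \<and> connected \<Omega> \<and> \<Omega> \<inter> \<real> \<noteq> {} \<and>
     (\<forall>\<alpha> \<beta>. \<forall>I\<in>imag_units. of_real \<alpha> + I * of_real \<beta> \<in> \<Omega> \<longrightarrow>
        (\<forall>J\<in>imag_units. of_real \<alpha> + J * of_real \<beta> \<in> \<Omega>))"

text \<open>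
  Functions on \<open>\<Omega>\<close> are represented by total functions of which only the values on \<open>\<Omega>\<close> matter.
  Holomorphy of \<open>f\<^sub>J\<close> means real (Frechet) differentiability in \<open>(\<alpha>, \<beta>)\<close> together with the
  Cauchy-Riemann equation; \<open>D (1, 0)\<close> and \<open>D (0, 1)\<close> are the partial derivatives with respect to
  \<open>\<alpha>\<close> and \<open>\<beta>\<close>.
\<close>

definition slice_regular :: "quat set \<Rightarrow> (quat \<Rightarrow> quat) \<Rightarrow> bool" where
  "slice_regular \<Omega> f \<longleftrightarrow>
     (\<forall>J\<in>imag_units. \<forall>\<alpha> \<beta>. of_real \<alpha> + J * of_real \<beta> \<in> \<Omega> \<longrightarrow>
        (\<exists>D. ((\<lambda>(a, b). f (of_real a + J * of_real b)) has_derivative D) (at (\<alpha>, \<beta>)) \<and>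
             (1 / 2) *\<^sub>R (D (1, 0) + J * D (0, 1)) = 0))"

definition slice_preserving :: "quat set \<Rightarrow> (quat \<Rightarrow> quat) \<Rightarrow> bool" where
  "slice_preserving \<Omega> f \<longleftrightarrow>
     slice_regular \<Omega> f \<and> (\<forall>I\<in>imag_units. f ` (\<Omega> \<inter> slice I) \<subseteq> slice I)"

definition preserves_no_slice :: "quat set \<Rightarrow> (quat \<Rightarrow> quat) \<Rightarrow> bool" where
  "preserves_no_slice \<Omega> f \<longleftrightarrow> (\<forall>J\<in>imag_units. \<not> f ` (\<Omega> \<inter> slice J) \<subseteq> slice J)"

text \<open>
  The decomposition \<open>f = f\<^sub>0 + f\<^sub>1 i + f\<^sub>2 j + f\<^sub>3 k\<close> with slice preserving \<open>f\<^sub>0, \<dots>, f\<^sub>3\<close>.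
  On a symmetric slice domain every slice regular function has exactly one, up to the irrelevant
  values outside \<open>\<Omega>\<close>; the latter are the reason for \<open>SOME\<close> instead of \<open>THE\<close>.
\<close>

definition slice_decomposition ::
  "quat set \<Rightarrow> (quat \<Rightarrow> quat) \<Rightarrow>
   (quat \<Rightarrow> quat) \<times> (quat \<Rightarrow> quat) \<times> (quat \<Rightarrow> quat) \<times> (quat \<Rightarrow> quat) \<Rightarrow> bool" where
  "slice_decomposition \<Omega> f = (\<lambda>(f0, f1, f2, f3).
     slice_preserving \<Omega> f0 \<and> slice_preserving \<Omega> f1 \<and>
     slice_preserving \<Omega> f2 \<and> slice_preserving \<Omega> f3 \<and>
     (\<forall>x\<in>\<Omega>. f x = f0 x + f1 x * quat_i + f2 x * quat_j + f3 x * quat_k))"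

definition slice_components ::
  "quat set \<Rightarrow> (quat \<Rightarrow> quat) \<Rightarrow>
   (quat \<Rightarrow> quat) \<times> (quat \<Rightarrow> quat) \<times> (quat \<Rightarrow> quat) \<times> (quat \<Rightarrow> quat)" where
  "slice_components \<Omega> f = (SOME c. slice_decomposition \<Omega> f c)"

definition real_part :: "quat set \<Rightarrow> (quat \<Rightarrow> quat) \<Rightarrow> quat \<Rightarrow> quat" where
  "real_part \<Omega> f = (case slice_components \<Omega> f of (f0, f1, f2, f3) \<Rightarrow> f0)"

text \<open>\<open>vec_symm \<Omega> f\<close> is \<open>f\<^sub>v\<^sup>s = f\<^sub>1\<^sup>2 + f\<^sub>2\<^sup>2 + f\<^sub>3\<^sup>2\<close>, where \<open>f\<^sub>v = f\<^sub>1 i + f\<^sub>2 j + f\<^sub>3 k\<close>.\<close>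

definition vec_symm :: "quat set \<Rightarrow> (quat \<Rightarrow> quat) \<Rightarrow> quat \<Rightarrow> quat" where
  "vec_symm \<Omega> f = (case slice_components \<Omega> f of (f0, f1, f2, f3) \<Rightarrow>
     (\<lambda>x. (f1 x)\<^sup>2 + (f2 x)\<^sup>2 + (f3 x)\<^sup>2))"

definition star_prod ::
  "quat set \<Rightarrow> (quat \<Rightarrow> quat) \<Rightarrow> (quat \<Rightarrow> quat) \<Rightarrow> quat \<Rightarrow> quat" where
  "star_prod \<Omega> f g =
     (case slice_components \<Omega> f of (f0, f1, f2, f3) \<Rightarrow>
      case slice_components \<Omega> g of (g0, g1, g2, g3) \<Rightarrow>
      (\<lambda>x. f0 x * g0 x - f1 x * g1 x - f2 x * g2 x - f3 x * g3 x
         + f0 x * (g1 x * quat_i + g2 x * quat_j + g3 x * quat_k)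
         + g0 x * (f1 x * quat_i + f2 x * quat_j + f3 x * quat_k)
         + (f2 x * g3 x - f3 x * g2 x) * quat_i
         + (f3 x * g1 x - f1 x * g3 x) * quat_j
         + (f1 x * g2 x - f2 x * g1 x) * quat_k))"

primrec star_power :: "quat set \<Rightarrow> (quat \<Rightarrow> quat) \<Rightarrow> nat \<Rightarrow> quat \<Rightarrow> quat" where
  "star_power \<Omega> f 0 = (\<lambda>_. 1)"
| "star_power \<Omega> f (Suc n) = star_prod \<Omega> f (star_power \<Omega> f n)"


section \<open>The polynomials \<open>Q\<^sub>d\<close> and their roots\<close>

definition Q_poly :: "nat \<Rightarrow> real \<Rightarrow> real \<Rightarrow> real" where
  "Q_poly d x y =
     (\<Sum>n = 0..(d - 1) div 2.
        (-1) ^ n * real (d choose (2 * n + 1)) * x ^ (d - (2 * n + 1)) * y ^ (2 * n + 1))"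

text \<open>The root \<open>[\<xi> : 1]\<close> in the projective line is identified with the real number \<open>\<xi>\<close>.\<close>

definition Sigma_roots :: "nat \<Rightarrow> real set" where
  "Sigma_roots d = {\<xi>. \<xi> \<noteq> 0 \<and> Q_poly d \<xi> 1 = 0}"

end

theory Submission
  imports Defs "HOL-Complex_Analysis.Complex_Analysis"
begin

text \<open>
  On each slice a slice preserving function is a copy of a single holomorphic stem function \<open>F\<close>
  on a connected domain of \<open>\<complex>\<close> with \<open>F (cnj z) = cnj (F z)\<close>.  Let \<open>F\<^sub>0, \<dots>, F\<^sub>3\<close> be the stems of the components
  of \<open>f\<close>, and \<open>S = F\<^sub>1\<^sup>2 + F\<^sub>2\<^sup>2 + F\<^sub>3\<^sup>2\<close>.  The vectorial part has star square \<open>- S\<close>, so the components of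
  the star power have stems \<open>P, R F\<^sub>1, R F\<^sub>2, R F\<^sub>3\<close> where \<open>P + R w = (F\<^sub>0 + w)\<^sup>d\<close> whenever \<open>w\<^sup>2 = - S\<close>.
  Holomorphic functions on a connected set form an integral domain, so the star power is slice
  preserving iff \<open>R\<close> vanishes.  With \<open>y\<^sup>2 = S\<close> one has \<open>y R = Q\<^sub>d(F\<^sub>0, y)\<close>, and \<open>Q\<^sub>d(t, 1) = 0\<close>
  means \<open>(t + \<i>)\<^sup>d = (t - \<i>)\<^sup>d\<close>, which forces \<open>t\<close> to be real.  Hence the product of \<open>F\<^sub>0\<^sup>2 - \<xi>\<^sup>2 S\<close> over the
  finitely many roots \<open>\<xi>\<close> vanishes wherever \<open>S\<close> does not, and one of its factors must vanish identically.
\<close>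

section \<open>Slices as copies of the complex plane\<close>

definition emb :: "quat \<Rightarrow> complex \<Rightarrow> quat" where
  "emb J z = of_real (Re z) + J * of_real (Im z)"

text \<open>For an imaginary unit \<open>J\<close> the number \<open>- qRe (J * q)\<close> is the
  inner product of \<open>q\<close> with \<open>J\<close>, so this is the orthogonal projection onto
  the slice of \<open>J\<close>, read in complex coordinates. It is defined on all quaternions,
  hence applies also to functions whose values leave the slice.\<close>

definition coord :: "quat \<Rightarrow> quat \<Rightarrow> complex" where
  "coord J q = Complex (qRe q) (- qRe (J * q))"

lemma quat_of_real_sel [simp]:
  "qRe (of_real a) = a" "qIm1 (of_real a) = 0" "qIm2 (of_real a) = 0" "qIm3 (of_real a) = 0"
  by (simp_all add: of_real_def)

lemma quat_basis_sel [simp]: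
  "qRe quat_i = 0" "qIm1 quat_i = 1" "qIm2 quat_i = 0" "qIm3 quat_i = 0"
  "qRe quat_j = 0" "qIm1 quat_j = 0" "qIm2 quat_j = 1" "qIm3 quat_j = 0"
  "qRe quat_k = 0" "qIm1 quat_k = 0" "qIm2 quat_k = 0" "qIm3 quat_k = 1"
  by (simp_all add: quat_i_def quat_j_def quat_k_def)

lemma emb_sel:
  "qRe (emb J z) = Re z + qRe J * Im z" "qIm1 (emb J z) = qIm1 J * Im z"
  "qIm2 (emb J z) = qIm2 J * Im z" "qIm3 (emb J z) = qIm3 J * Im z"
  by (simp_all add: emb_def)

lemma imag_units_square: "J \<in> imag_units \<Longrightarrow> J * J = -1"
  by (simp add: imag_units_def power2_eq_square)

text \<open>The vector part of \<open>J * J\<close> is twice \<open>qRe J\<close> times that of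
  \<open>J\<close>. So one of the two factors vanishes, and a real \<open>J\<close> cannot have
  square -1.\<close>

lemma imag_units_iff:
  "J \<in> imag_units \<longleftrightarrow> qRe J = 0 \<and> (qIm1 J)\<^sup>2 + (qIm2 J)\<^sup>2 + (qIm3 J)\<^sup>2 = 1"
proof
  assume J: "J \<in> imag_units"
  then have e: "J * J = -1" by (rule imag_units_square)
  have r: "(qRe J)\<^sup>2 - (qIm1 J)\<^sup>2 - (qIm2 J)\<^sup>2 - (qIm3 J)\<^sup>2 = -1"
    using arg_cong[OF e, of qRe] by (simp add: power2_eq_square)
  have "qRe J * qIm1 J = 0" "qRe J * qIm2 J = 0" "qRe J * qIm3 J = 0"
    using arg_cong[OF e, of qIm1] arg_cong[OF e, of qIm2] arg_cong[OF e, of qIm3]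
    by (simp_all add: algebra_simps)
  then have "qRe J = 0 \<or> qIm1 J = 0 \<and> qIm2 J = 0 \<and> qIm3 J = 0" by auto
  then show "qRe J = 0 \<and> (qIm1 J)\<^sup>2 + (qIm2 J)\<^sup>2 + (qIm3 J)\<^sup>2 = 1"
  proof
    assume "qIm1 J = 0 \<and> qIm2 J = 0 \<and> qIm3 J = 0"
    then have "(qRe J)\<^sup>2 = -1" using r by simp
    then show ?thesis by (metis zero_le_power2 not_one_le_zero neg_0_le_iff_le)
  qed (use r in auto)
next
  assume "qRe J = 0 \<and> (qIm1 J)\<^sup>2 + (qIm2 J)\<^sup>2 + (qIm3 J)\<^sup>2 = 1"
  then show "J \<in> imag_units"
    by (auto simp: imag_units_def quat_eq_iff power2_eq_square)
qed

lemma imag_units_basis [simp]: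
  "quat_i \<in> imag_units" "quat_j \<in> imag_units" "quat_k \<in> imag_units"
  by (simp_all add: imag_units_iff)

lemma imag_units_minus: "J \<in> imag_units \<Longrightarrow> - J \<in> imag_units"
  by (simp add: imag_units_iff)

lemma quat_i_times_j: "quat_i * quat_j = quat_k"
  by (simp add: quat_eq_iff)

lemma emb_add: "emb J (w + z) = emb J w + emb J z"
  by (simp add: emb_def algebra_simps)

lemma emb_diff: "emb J (w - z) = emb J w - emb J z"
  by (simp add: emb_def algebra_simps)

lemma emb_of_real [simp]: "emb J (of_real a) = of_real a"
  by (simp add: emb_def)

lemma emb_0 [simp]: "emb J 0 = 0"
  by (simp add: emb_def)

lemma emb_uminus_unit: "emb (- J) z = emb J (cnj z)"
  by (simp add: emb_def)

lemma emb_mult: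
  assumes "J \<in> imag_units"
  shows "emb J (w * z) = emb J w * emb J z"
  using assms unfolding imag_units_iff
  by (simp add: quat_eq_iff emb_sel) algebra

lemma emb_power:
  assumes "J \<in> imag_units"
  shows "emb J (z ^ n) = emb J z ^ n"
  using emb_of_real[of J 1] by (induction n) (simp_all add: emb_mult[OF assms])

lemma emb_imaginary_unit: "emb J \<i> = J"
  by (simp add: emb_def)

lemma bounded_linear_emb: "bounded_linear (emb J)"
proof -
  have eq: "emb J = (\<lambda>z. of_real (Re z) + J * of_real (Im z))"
    by (simp add: emb_def fun_eq_iff)
  show ?thesis unfolding eq
    by (intro bounded_linear_add bounded_linear_compose[OF bounded_linear_of_real bounded_linear_Re]
        bounded_linear_compose[OF bounded_linear_mult_right]
        bounded_linear_compose[OF bounded_linear_of_real bounded_linear_Im])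
qed

lemma bounded_linear_qRe: "bounded_linear qRe"
proof -
  have eq: "qRe = (\<lambda>q. inner q 1)" by (simp add: inner_quat_def fun_eq_iff)
  show ?thesis unfolding eq by (rule bounded_linear_inner_left)
qed

lemma bounded_linear_coord: "bounded_linear (coord J)"
proof -
  have eq: "coord J = (\<lambda>q. of_real (qRe q) + \<i> * of_real (- qRe (J * q)))"
    by (simp add: coord_def fun_eq_iff complex_eq_iff)
  show ?thesis unfolding eq
    by (intro bounded_linear_add bounded_linear_compose[OF bounded_linear_of_real bounded_linear_qRe]
        bounded_linear_compose[OF bounded_linear_mult_right]
        bounded_linear_compose[OF bounded_linear_of_real] bounded_linear_minus
        bounded_linear_compose[OF bounded_linear_qRe] bounded_linear_mult_right)
qed

text \<open>The projection is complex linear for multiplication by the slice from the left, the side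
  on which \<open>J\<close> acts in the Cauchy-Riemann equation. This turns slice regular functions
  into holomorphic ones.\<close>

lemma coord_emb_mult:
  assumes "J \<in> imag_units"
  shows "coord J (emb J w * q) = w * coord J q"
  using assms unfolding imag_units_iff
  by (simp add: complex_eq_iff coord_def emb_sel) algebra

lemma coord_emb:
  assumes "J \<in> imag_units"
  shows "coord J (emb J w) = w"
  using coord_emb_mult[OF assms, of w 1] assms
  by (simp add: coord_def imag_units_iff one_complex.code[symmetric])

lemma emb_inject:
  assumes "J \<in> imag_units"
  shows "emb J w = emb J z \<longleftrightarrow> w = z"
  using coord_emb[OF assms] by metis

lemma slice_eq_range: "slice J = range (emb J)"
proof -
  have "slice J = {q. \<exists>a b. q = a *\<^sub>R 1 + b *\<^sub>R J}"
    by (auto simp: slice_def span_insert span_singleton eq_diff_eq diff_eq_eq add.commute)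
  also have "\<dots> = range (emb J)"
  proof (intro set_eqI iffI)
    fix q assume "q \<in> {q. \<exists>a b. q = a *\<^sub>R 1 + b *\<^sub>R J}"
    then obtain a b where "q = a *\<^sub>R 1 + b *\<^sub>R J" by auto
    then have "q = emb J (Complex a b)" by (simp add: quat_eq_iff emb_sel)
    then show "q \<in> range (emb J)" by simp
  next
    fix q assume "q \<in> range (emb J)"
    then obtain z where "q = emb J z" by auto
    then have "q = Re z *\<^sub>R 1 + Im z *\<^sub>R J" by (simp add: quat_eq_iff emb_sel)
    then show "q \<in> {q. \<exists>a b. q = a *\<^sub>R 1 + b *\<^sub>R J}" by blast
  qed
  finally show ?thesis .
qed

section \<open>Polar form of a quaternion\<close>

definition upper :: "quat \<Rightarrow> complex" where
  "upper q = Complex (qRe q) (norm (q - of_real (qRe q)))"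

text \<open>Together with \<open>upper\<close> this writes \<open>q\<close> as a value of
  \<open>emb\<close>, with the representative of nonnegative imaginary part. At real points any
  imaginary unit would do; \<open>quat_i\<close> is an arbitrary choice.\<close>

definition dir :: "quat \<Rightarrow> quat" where
  "dir q = (if q = of_real (qRe q) then quat_i else sgn (q - of_real (qRe q)))"

lemma norm_imag_unit: "J \<in> imag_units \<Longrightarrow> norm J = 1"
  by (simp add: imag_units_iff norm_quat_def)

lemma dir_imag_unit: "dir q \<in> imag_units"
proof (cases "q = of_real (qRe q)")
  case False
  define v where "v = sgn (q - of_real (qRe q))"
  have "norm v = 1" using False by (simp add: v_def norm_sgn)
  moreover have "qRe v = 0" by (simp add: v_def sgn_quat_def)
  ultimately have "v \<in> imag_units" by (simp add: imag_units_iff norm_quat_def)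
  then show ?thesis using False by (simp add: dir_def v_def)
qed (simp add: dir_def)

lemma emb_dir_upper: "emb (dir q) (upper q) = q"
proof (cases "q = of_real (qRe q)")
  case True
  then show ?thesis by (metis emb_of_real upper_def complex_of_real_def norm_zero diff_self)
next
  case False
  define v where "v = q - of_real (qRe q)"
  have v0: "v \<noteq> 0" using False by (simp add: v_def)
  have "sgn v * of_real (norm v) = v"
    using v0 by (simp add: of_real_def sgn_div_norm)
  then show ?thesis using False by (simp add: emb_def dir_def upper_def flip: v_def) (simp add: v_def)
qed

lemma emb_minus_real_part:
  assumes "J \<in> imag_units"
  shows "emb J z - of_real (qRe (emb J z)) = Im z *\<^sub>R J"
  using assms by (simp add: quat_eq_iff emb_sel imag_units_iff)

lemma upper_emb:
  assumes "J \<in> imag_units"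
  shows "upper (emb J z) = (if Im z \<ge> 0 then z else cnj z)"
  unfolding upper_def emb_minus_real_part[OF assms]
  using assms norm_imag_unit[OF assms] by (simp add: complex_eq_iff emb_sel imag_units_iff)

lemma dir_emb:
  assumes "J \<in> imag_units"
  shows "dir (emb J z) = (if Im z > 0 then J else if Im z < 0 then - J else quat_i)"
proof -
  have J0: "J \<noteq> 0" using norm_imag_unit[OF assms] by auto
  have "emb J z = of_real (qRe (emb J z)) \<longleftrightarrow> Im z *\<^sub>R J = 0"
    using emb_minus_real_part[OF assms, of z] by (metis eq_iff_diff_eq_0)
  then show ?thesis
    using J0 norm_imag_unit[OF assms]
    by (auto simp: dir_def emb_minus_real_part[OF assms] sgn_scaleR sgn_div_norm)
qed

lemma exists_emb: "\<exists>J\<in>imag_units. \<exists>z. q = emb J z"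
  using dir_imag_unit emb_dir_upper by metis

lemma continuous_on_upper: "continuous_on A upper"
proof -
  have eq: "upper = (\<lambda>q. of_real (qRe q) + \<i> * of_real (norm (q - of_real (qRe q))))"
    by (simp add: upper_def fun_eq_iff complex_eq_iff)
  show ?thesis unfolding eq
    by (intro continuous_intros bounded_linear.continuous_on[OF bounded_linear_qRe])
qed

section \<open>Slice regularity as complex differentiability\<close>

text \<open>The Cauchy-Riemann equation says \<open>D (0, 1) = J * D (1, 0)\<close>, so the real
  differential is determined by the quaternion \<open>c = D (1, 0)\<close>, on which complex numbers
  act from the left.\<close>

lemma slice_regular_iff:
  "slice_regular \<Omega> f \<longleftrightarrow>
     (\<forall>J\<in>imag_units. \<forall>z. emb J z \<in> \<Omega> \<longrightarrow>
        (\<exists>c. ((\<lambda>w. f (emb J w)) has_derivative (\<lambda>w. emb J w * c)) (at z)))" (is "_ \<longleftrightarrow> ?R")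
proof
  assume L: "slice_regular \<Omega> f"
  show ?R
  proof (intro ballI allI impI)
    fix J z assume J: "J \<in> imag_units" and z: "emb J z \<in> \<Omega>"
    obtain D where D: "((\<lambda>(a, b). f (of_real a + J * of_real b)) has_derivative D) (at (Re z, Im z))"
      and CR: "(1/2) *\<^sub>R (D (1, 0) + J * D (0, 1)) = 0"
      using L J z unfolding slice_regular_def emb_def by meson
    have "((\<lambda>w. (Re w, Im w)) has_derivative (\<lambda>w. (Re w, Im w))) (at z)"
      by (intro bounded_linear_imp_has_derivative bounded_linear_Pair bounded_linear_Re bounded_linear_Im)
    from has_derivative_compose[OF this D]
    have der: "((\<lambda>w. f (emb J w)) has_derivative (\<lambda>w. D (Re w, Im w))) (at z)"
      by (simp add: emb_def)
    have lin: "linear D" using D has_derivative_linear by blast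
    have "D (1, 0) + J * D (0, 1) = 0" using CR by simp
    then have "J * D (1, 0) + (J * J) * D (0, 1) = 0"
      by (metis distrib_left mult.assoc mult_zero_right)
    then have D01: "D (0, 1) = J * D (1, 0)" by (simp add: imag_units_square[OF J])
    have "D (Re w, Im w) = emb J w * D (1, 0)" for w
    proof -
      have "D (Re w, Im w) = D (Re w *\<^sub>R (1, 0) + Im w *\<^sub>R (0, 1))" by simp
      also have "\<dots> = Re w *\<^sub>R D (1, 0) + Im w *\<^sub>R D (0, 1)"
        by (simp only: linear_add[OF lin] linear_scale[OF lin])
      also have "\<dots> = emb J w * D (1, 0)"
        by (simp add: D01 emb_def Real_Vector_Spaces.of_real_def distrib_right)
      finally show ?thesis .
    qed
    with der show "\<exists>c. ((\<lambda>w. f (emb J w)) has_derivative (\<lambda>w. emb J w * c)) (at z)"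
      by auto
  qed
next
  assume R: ?R
  show "slice_regular \<Omega> f"
    unfolding slice_regular_def
  proof (intro ballI allI impI)
    fix J \<alpha> \<beta> assume J: "J \<in> imag_units" and z: "of_real \<alpha> + J * of_real \<beta> \<in> \<Omega>"
    then have "emb J (Complex \<alpha> \<beta>) \<in> \<Omega>" by (simp add: emb_def)
    then obtain c where c: "((\<lambda>w. f (emb J w)) has_derivative (\<lambda>w. emb J w * c)) (at (Complex \<alpha> \<beta>))"
      using R J by blast
    have eq: "(\<lambda>x. Complex (fst x) (snd x)) = (\<lambda>x. of_real (fst x) + \<i> * of_real (snd x))"
      by (simp add: fun_eq_iff complex_eq_iff)
    have "bounded_linear (\<lambda>x. Complex (fst x) (snd x))" unfolding eq
      by (intro bounded_linear_add bounded_linear_compose[OF bounded_linear_mult_right]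
        bounded_linear_compose[OF bounded_linear_of_real] bounded_linear_fst bounded_linear_snd)
    then have "((\<lambda>x. Complex (fst x) (snd x)) has_derivative (\<lambda>x. Complex (fst x) (snd x))) (at (\<alpha>, \<beta>))"
      by (rule bounded_linear_imp_has_derivative)
    moreover have "((\<lambda>w. f (emb J w)) has_derivative (\<lambda>w. emb J w * c))
        (at (Complex (fst (\<alpha>, \<beta>)) (snd (\<alpha>, \<beta>))))"
      using c by simp
    ultimately have "((\<lambda>x. f (emb J (Complex (fst x) (snd x)))) has_derivative
        (\<lambda>x. emb J (Complex (fst x) (snd x)) * c)) (at (\<alpha>, \<beta>))"
      by (rule has_derivative_compose)
    then have "((\<lambda>(a, b). f (of_real a + J * of_real b)) has_derivative
        (\<lambda>x. emb J (Complex (fst x) (snd x)) * c)) (at (\<alpha>, \<beta>))"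
      by (simp add: emb_def case_prod_unfold)
    moreover have "(1/2) *\<^sub>R (emb J (Complex 1 0) * c + J * (emb J (Complex 0 1) * c)) = 0"
      by (simp add: emb_def imag_units_square[OF J] flip: mult.assoc)
    ultimately show "\<exists>D. ((\<lambda>(a, b). f (of_real a + J * of_real b)) has_derivative D) (at (\<alpha>, \<beta>)) \<and>
             (1 / 2) *\<^sub>R (D (1, 0) + J * D (0, 1)) = 0"
      by (intro exI[of _ "\<lambda>x. emb J (Complex (fst x) (snd x)) * c"]) simp
  qed
qed

lemma slice_regular_add:
  assumes "slice_regular \<Omega> f" "slice_regular \<Omega> g"
  shows "slice_regular \<Omega> (\<lambda>x. f x + g x)"
  unfolding slice_regular_iff
proof (intro ballI allI impI)
  fix J z assume J: "J \<in> imag_units" and z: "emb J z \<in> \<Omega>"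
  obtain c d where "((\<lambda>w. f (emb J w)) has_derivative (\<lambda>w. emb J w * c)) (at z)"
    "((\<lambda>w. g (emb J w)) has_derivative (\<lambda>w. emb J w * d)) (at z)"
    using assms J z unfolding slice_regular_iff by meson
  from has_derivative_add[OF this]
  show "\<exists>c. ((\<lambda>w. f (emb J w) + g (emb J w)) has_derivative (\<lambda>w. emb J w * c)) (at z)"
    by (intro exI[of _ "c + d"]) (simp add: algebra_simps)
qed

text \<open>The constant stands on the right because the complex structure acts from the left;
  associativity makes the two actions commute.\<close>

lemma slice_regular_mult_const:
  assumes "slice_regular \<Omega> f"
  shows "slice_regular \<Omega> (\<lambda>x. f x * q)"
  unfolding slice_regular_iff
proof (intro ballI allI impI)
  fix J z assume J: "J \<in> imag_units" and z: "emb J z \<in> \<Omega>"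
  obtain c where "((\<lambda>w. f (emb J w)) has_derivative (\<lambda>w. emb J w * c)) (at z)"
    using assms J z unfolding slice_regular_iff by meson
  from has_derivative_mult_left[OF this, of q]
  show "\<exists>c. ((\<lambda>w. f (emb J w) * q) has_derivative (\<lambda>w. emb J w * c)) (at z)"
    by (intro exI[of _ "c * q"]) (simp add: mult.assoc)
qed

section \<open>Stem functions\<close>

locale slice_domain =
  fixes \<Omega> :: "quat set"
  assumes domain: "symmetric_slice_domain \<Omega>"
begin

text \<open>By symmetry every slice cuts out the same set, so \<open>quat_i\<close> is only a choice
  of representative.\<close>

definition D :: "complex set" where
  "D = {z. emb quat_i z \<in> \<Omega>}"

lemma emb_in_iff:
  assumes "J \<in> imag_units"
  shows "emb J z \<in> \<Omega> \<longleftrightarrow> z \<in> D"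
  using domain assms imag_units_basis(1) unfolding symmetric_slice_domain_def D_def emb_def mem_Collect_eq
  by blast

lemma of_real_in_iff: "of_real a \<in> \<Omega> \<longleftrightarrow> of_real a \<in> D"
  by (simp add: D_def)

lemma cnj_in_iff: "cnj z \<in> D \<longleftrightarrow> z \<in> D"
  using emb_in_iff[OF imag_units_basis(1), of "cnj z"]
    emb_in_iff[OF imag_units_minus[OF imag_units_basis(1)], of z]
  by (simp add: emb_uminus_unit)

lemma exists_real: "\<exists>a::real. of_real a \<in> D"
  using domain unfolding symmetric_slice_domain_def by (auto simp: Reals_def simp flip: of_real_in_iff)

lemma exists_emb_in:
  assumes "x \<in> \<Omega>"
  obtains J z where "J \<in> imag_units" "z \<in> D" "x = emb J z"
  using exists_emb[of x] assms emb_in_iff by blast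

lemma open_D: "open D"
proof -
  have "D = emb quat_i -` \<Omega>" by (auto simp: D_def)
  then show ?thesis
    using domain linear_continuous_on[OF bounded_linear_emb, of UNIV]
    by (simp add: symmetric_slice_domain_def open_vimage)
qed

text \<open>\<open>D\<close> is the union of the upper representatives of the points of \<Omega> and
  their conjugates. Both pieces are continuous images of connected sets, and they meet because
  \<Omega> contains a real point.\<close>

lemma connected_D: "connected D"
proof -
  let ?U = "upper ` \<Omega>"
  have U: "?U \<subseteq> D"
  proof
    fix z assume "z \<in> ?U"
    then obtain q where "q \<in> \<Omega>" "z = upper q" by auto
    then show "z \<in> D" using emb_in_iff[OF dir_imag_unit[of q]] emb_dir_upper by metis
  qed
  have "z \<in> ?U \<union> cnj ` ?U" if "z \<in> D" for z
  proof -
    have "upper (emb quat_i z) \<in> ?U" using that by (simp add: D_def)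
    then show ?thesis by (auto simp: upper_emb image_iff split: if_splits) (metis complex_cnj_cnj)
  qed
  then have eq: "D = ?U \<union> cnj ` ?U" using U cnj_in_iff by blast
  have conU: "connected ?U"
    using domain by (intro connected_continuous_image continuous_on_upper)
      (simp add: symmetric_slice_domain_def)
  then have con: "connected (cnj ` ?U)"
    by (rule connected_continuous_image[rotated]) (intro continuous_intros)
  obtain a :: real where "complex_of_real a \<in> D" using exists_real by blast
  then have "emb quat_i (of_real a) \<in> \<Omega>" by (simp add: D_def)
  then have "complex_of_real a \<in> ?U"
    using upper_emb[OF imag_units_basis(1), of "of_real a"] by (metis Im_complex_of_real image_eqI order_refl)
  moreover from this have "complex_of_real a \<in> cnj ` ?U"
    by (metis complex_cnj_complex_of_real image_eqI)
  ultimately show ?thesis unfolding eq using conU con by (intro connected_Un) auto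
qed

section \<open>The identity principle and its consequences\<close>

lemma holomorphic_eq_of_real:
  assumes "F holomorphic_on D" "G holomorphic_on D"
    and "\<And>a::real. of_real a \<in> D \<Longrightarrow> F (of_real a) = G (of_real a)"
    and "z \<in> D"
  shows "F z = G z"
proof -
  obtain a :: real where a: "of_real a \<in> D" using exists_real by blast
  then obtain r where r: "r > 0" "ball (complex_of_real a) r \<subseteq> D"
    using open_D open_contains_ball by metis
  \<comment> \<open>A disc in \<open>D\<close> around a real point contains other real points
    arbitrarily close to its centre, and agreement on them suffices for analytic
    continuation.\<close>
  have "complex_of_real a islimpt (D \<inter> \<real>)"
    unfolding islimpt_approachable
  proof (intro allI impI)
    fix e :: real assume "0 < e"
    define b where "b = a + min e r / 2"
    have "dist (complex_of_real b) (of_real a) = min e r / 2"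
      using r \<open>0 < e\<close> by (simp add: b_def dist_norm flip: of_real_diff)
    moreover have "b \<noteq> a" using r \<open>0 < e\<close> by (simp add: b_def)
    moreover from calculation have "dist (complex_of_real b) (of_real a) < e"
      "dist (complex_of_real b) (of_real a) < r"
      using r \<open>0 < e\<close> by auto
    moreover from this have "complex_of_real b \<in> D"
      using r(2) by (auto simp: dist_commute)
    ultimately show "\<exists>x'\<in>D \<inter> \<real>. x' \<noteq> complex_of_real a \<and> dist x' (of_real a) < e"
      by (intro bexI[of _ "of_real b"]) auto
  qed
  moreover have "(\<lambda>z. F z - G z) holomorphic_on D"
    using assms by (intro holomorphic_intros)
  moreover have "F w - G w = 0" if "w \<in> D \<inter> \<real>" for w
    using that assms(3) unfolding Reals_def by auto
  ultimately have "F z - G z = 0"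
    using analytic_continuation[of "\<lambda>z. F z - G z" D "D \<inter> \<real>" "of_real a" z]
      open_D connected_D a assms(4) by blast
  then show ?thesis by simp
qed

text \<open>Where \<open>G\<close> is nonzero, \<open>F\<close> vanishes. If this open set is
  nonempty, the identity theorem spreads the vanishing over the connected set
  \<open>D\<close>.\<close>

lemma holomorphic_mult_eq_0:
  assumes F: "F holomorphic_on D" and G: "G holomorphic_on D"
    and 0: "\<And>z. z \<in> D \<Longrightarrow> F z * G z = 0"
  shows "(\<forall>z\<in>D. F z = 0) \<or> (\<forall>z\<in>D. G z = 0)"
proof (rule disjCI)
  assume "\<not> (\<forall>z\<in>D. G z = 0)"
  then have ne: "{z \<in> D. G z \<noteq> 0} \<noteq> {}" by auto
  have op: "open {z \<in> D. G z \<noteq> 0}"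
    using continuous_open_preimage[OF holomorphic_on_imp_continuous_on[OF G] open_D, of "- {0}"]
    by (simp add: vimage_def Int_def open_Compl)
  show "\<forall>z\<in>D. F z = 0"
    using analytic_continuation_open[OF op open_D ne connected_D _ F holomorphic_on_const[of 0]] 0
    by auto
qed

lemma holomorphic_prod_eq_0:
  assumes "finite A" "\<And>a. a \<in> A \<Longrightarrow> F a holomorphic_on D"
    and "\<And>z. z \<in> D \<Longrightarrow> (\<Prod>a\<in>A. F a z) = 0"
  shows "\<exists>a\<in>A. \<forall>z\<in>D. F a z = 0"
  using assms
proof (induction A rule: finite_induct)
  case empty
  \<comment> \<open>The empty product is 1, which contradicts the hypothesis at a real point of
    \<open>D\<close>.\<close>
  then show ?case using exists_real by auto
next
  case (insert a A)
  have "(\<forall>z\<in>D. F a z = 0) \<or> (\<forall>z\<in>D. (\<Prod>a\<in>A. F a z) = 0)"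
    using insert by (intro holomorphic_mult_eq_0 holomorphic_on_prod) auto
  then show ?case using insert by auto
qed

lemma slice_regular_coord_holomorphic:
  assumes f: "slice_regular \<Omega> f" and J: "J \<in> imag_units"
  shows "(\<lambda>z. coord J (f (emb J z))) holomorphic_on D"
proof (rule holomorphic_onI)
  fix z assume "z \<in> D"
  then have "emb J z \<in> \<Omega>" using J emb_in_iff by blast
  then obtain c where "((\<lambda>w. f (emb J w)) has_derivative (\<lambda>w. emb J w * c)) (at z)"
    using f J unfolding slice_regular_iff by blast
  from bounded_linear.has_derivative[OF bounded_linear_coord this, of J]
  have "((\<lambda>z. coord J (f (emb J z))) has_field_derivative coord J c) (at z)"
    by (simp add: has_field_derivative_def coord_emb_mult[OF J] mult_commute_abs)
  then show "(\<lambda>z. coord J (f (emb J z))) field_differentiable at z within D"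
    using field_differentiable_at_within field_differentiable_def by blast
qed

text \<open>The identity theorem applies, on a slice through \<open>x\<close>, to the projections of
  \<open>f\<close> and \<open>g\<close> multiplied by a constant \<open>c\<close>. The real parts of
  \<open>f x * c\<close> for the four basis elements \<open>c\<close> recover all coordinates of
  \<open>f x\<close>.\<close>

lemma slice_regular_eq_of_real:
  assumes f: "slice_regular \<Omega> f" and g: "slice_regular \<Omega> g"
    and eq: "\<And>a. of_real a \<in> \<Omega> \<Longrightarrow> f (of_real a) = g (of_real a)"
    and x: "x \<in> \<Omega>"
  shows "f x = g x"
proof -
  obtain J z where J: "J \<in> imag_units" and z: "z \<in> D" "x = emb J z"
    using exists_emb_in[OF x] .
  have "coord J (f x * c) = coord J (g x * c)" for c
    unfolding z(2)
    by (rule holomorphic_eq_of_real[OF slice_regular_coord_holomorphic[OF slice_regular_mult_const[OF f] J]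
          slice_regular_coord_holomorphic[OF slice_regular_mult_const[OF g] J] _ z(1)])
      (simp add: eq of_real_in_iff)
  then have re: "qRe (f x * c) = qRe (g x * c)" for c
    by (simp add: coord_def)
  show ?thesis
    using re[of 1] re[of quat_i] re[of quat_j] re[of quat_k] by (simp add: quat_eq_iff)
qed

definition stem :: "(complex \<Rightarrow> complex) \<Rightarrow> (quat \<Rightarrow> quat) \<Rightarrow> bool" where
  "stem F f \<longleftrightarrow> F holomorphic_on D \<and> (\<forall>z\<in>D. F (cnj z) = cnj (F z)) \<and>
     (\<forall>J\<in>imag_units. \<forall>z\<in>D. f (emb J z) = emb J (F z))"

lemma stem_holomorphic: "stem F f \<Longrightarrow> F holomorphic_on D"
  by (simp add: stem_def)

lemma stem_cnj: "stem F f \<Longrightarrow> z \<in> D \<Longrightarrow> F (cnj z) = cnj (F z)"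
  by (simp add: stem_def)

lemma stem_emb: "stem F f \<Longrightarrow> J \<in> imag_units \<Longrightarrow> z \<in> D \<Longrightarrow> f (emb J z) = emb J (F z)"
  by (simp add: stem_def)

lemma slice_preserving_if_stem:
  assumes st: "stem F f"
  shows "slice_preserving \<Omega> f"
  unfolding slice_preserving_def slice_regular_iff
proof (intro conjI ballI allI impI subsetI)
  fix J z assume J: "J \<in> imag_units" and "emb J z \<in> \<Omega>"
  then have z: "z \<in> D" using emb_in_iff by blast
  then obtain c where "(F has_field_derivative c) (at z)"
    using stem_holomorphic[OF st] open_D holomorphic_derivI by blast
  then have "((\<lambda>w. emb J (F w)) has_derivative (\<lambda>w. emb J (c * w))) (at z)"
    unfolding has_field_derivative_def
    by (rule bounded_linear.has_derivative[OF bounded_linear_emb])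
  then have "((\<lambda>w. f (emb J w)) has_derivative (\<lambda>w. emb J (c * w))) (at z)"
    by (rule has_derivative_transform_within_open[OF _ open_D z]) (simp add: stem_emb[OF st J])
  then show "\<exists>c. ((\<lambda>w. f (emb J w)) has_derivative (\<lambda>w. emb J w * c)) (at z)"
    by (intro exI[of _ "emb J c"]) (simp add: mult.commute[of c] emb_mult[OF J])
next
  fix J y assume J: "J \<in> imag_units" and "y \<in> f ` (\<Omega> \<inter> slice J)"
  then obtain z where "z \<in> D" "y = f (emb J z)"
    using emb_in_iff by (auto simp: slice_eq_range)
  then show "y \<in> slice J" using stem_emb[OF st J] by (simp add: slice_eq_range)
qed

text \<open>The coordinates of \<open>f\<close> on the various slices are holomorphic on
  \<open>D\<close> and agree at real points, hence everywhere. Conjugation symmetry comes from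
  parametrizing the slice of \<open>quat_i\<close> also by \<open>- quat_i\<close>.\<close>

lemma stem_if_slice_preserving:
  assumes f: "slice_preserving \<Omega> f"
  obtains F where "stem F f"
proof -
  have reg: "slice_regular \<Omega> f" using f by (simp add: slice_preserving_def)
  define F where "F J z = coord J (f (emb J z))" for J z
  have F: "f (emb J z) = emb J (F J z)" if J: "J \<in> imag_units" and z: "z \<in> D" for J z
  proof -
    have "f (emb J z) \<in> slice J"
      using f J z emb_in_iff[OF J] unfolding slice_preserving_def slice_eq_range by blast
    then show ?thesis by (auto simp: slice_eq_range F_def coord_emb[OF J])
  qed
  have indep: "F J z = F quat_i z" if J: "J \<in> imag_units" and "z \<in> D" for J z
  proof (rule holomorphic_eq_of_real[OF _ _ _ \<open>z \<in> D\<close>])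
    show "F J holomorphic_on D" "F quat_i holomorphic_on D"
      unfolding F_def using slice_regular_coord_holomorphic[OF reg] J by auto
    fix a :: real assume a: "of_real a \<in> D"
    \<comment> \<open>The slices of \<open>quat_i\<close> and \<open>quat_j\<close> meet only in the
      real line, so \<open>f\<close> is real at real points.\<close>
    have "f (of_real a) = emb quat_i (F quat_i (of_real a))" "f (of_real a) = emb quat_j (F quat_j (of_real a))"
      using F[OF imag_units_basis(1) a] F[OF imag_units_basis(2) a] by simp_all
    then have "f (of_real a) = of_real (qRe (f (of_real a)))"
      by (metis (no_types, lifting) emb_sel quat_eq_iff mult_zero_left quat_basis_sel quat_of_real_sel)
    then obtain b where "f (of_real a) = of_real b" by blast
    then show "F J (of_real a) = F quat_i (of_real a)"
      unfolding F_def emb_of_real using coord_emb[OF J, of "of_real b"] coord_emb[OF imag_units_basis(1), of "of_real b"]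
      by simp
  qed
  have "stem (F quat_i) f"
    unfolding stem_def
  proof (intro conjI ballI)
    show "F quat_i holomorphic_on D"
      unfolding F_def using slice_regular_coord_holomorphic[OF reg] by simp
    show "f (emb J z) = emb J (F quat_i z)" if "J \<in> imag_units" "z \<in> D" for J z
      using F[OF that] indep[OF that] by metis
    show "F quat_i (cnj z) = cnj (F quat_i z)" if z: "z \<in> D" for z
    proof -
      have m: "- quat_i \<in> imag_units" using imag_units_minus by simp
      have "emb quat_i (F quat_i (cnj z)) = f (emb quat_i (cnj z))"
        using F z cnj_in_iff by simp
      also have "\<dots> = f (emb (- quat_i) z)" by (simp add: emb_uminus_unit)
      also have "\<dots> = emb (- quat_i) (F quat_i z)" using F[OF m z] indep[OF m z] by metis
      also have "\<dots> = emb quat_i (cnj (F quat_i z))" by (simp add: emb_uminus_unit)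
      finally show ?thesis by (simp add: emb_inject)
    qed
  qed
  then show ?thesis using that by blast
qed

text \<open>The function is built in polar form. Conjugation symmetry makes it correct on the lower
  half plane and forces \<open>F\<close> to be real at real points, where the choice made in
  \<open>dir\<close> therefore has no effect.\<close>

lemma exists_stem:
  assumes hol: "F holomorphic_on D" and sym: "\<And>z. z \<in> D \<Longrightarrow> F (cnj z) = cnj (F z)"
  obtains f where "stem F f"
proof -
  define f where "f q = emb (dir q) (F (upper q))" for q
  have "f (emb J z) = emb J (F z)" if J: "J \<in> imag_units" and z: "z \<in> D" for J z
  proof (cases "Im z = 0")
    case True
    then have "cnj z = z" by (simp add: complex_eq_iff)
    then have "cnj (F z) = F z" using sym[OF z] by simp
    then have "Im (F z) = 0" by (simp add: complex_eq_iff)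
    then show ?thesis using True J by (simp add: f_def upper_emb dir_emb) (simp add: emb_def)
  next
    case False
    then show ?thesis using J sym[OF z] by (auto simp: f_def upper_emb dir_emb emb_uminus_unit)
  qed
  then have "stem F f" using assms by (simp add: stem_def)
  then show ?thesis using that by blast
qed

lemma slice_decomposition_if_stem:
  assumes "stem F0 f0" "stem F1 f1" "stem F2 f2" "stem F3 f3"
    and "\<And>x. x \<in> \<Omega> \<Longrightarrow> f x = f0 x + f1 x * quat_i + f2 x * quat_j + f3 x * quat_k"
  shows "slice_decomposition \<Omega> f (f0, f1, f2, f3)"
  using assms slice_preserving_if_stem unfolding slice_decomposition_def by blast

section \<open>Existence and uniqueness of the slice decomposition\<close>

lemma exists_slice_decomposition:
  assumes f: "slice_regular \<Omega> f"
  shows "\<exists>c. slice_decomposition \<Omega> f c"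
proof -
  \<comment> \<open>Splitting over the slice of \<open>quat_i\<close>: there \<open>f\<close> is
    \<open>A + B * quat_j\<close>, and right multiplication by \<open>- quat_j\<close> moves the
    second coefficient into the slice, where the projection reads it off.\<close>
  define A where "A z = coord quat_i (f (emb quat_i z))" for z
  define B where "B z = coord quat_i (f (emb quat_i z) * (- quat_j))" for z
  have hol: "A holomorphic_on D" "B holomorphic_on D"
    unfolding A_def B_def
    by (rule slice_regular_coord_holomorphic[OF f] slice_regular_coord_holomorphic[OF slice_regular_mult_const[OF f]];
        simp)+
  have AB: "f (emb quat_i z) = emb quat_i (A z) + emb quat_i (B z) * quat_j" for z
    by (simp add: A_def B_def quat_eq_iff emb_sel coord_def)
  \<comment> \<open>At real points these are the real and imaginary parts of \<open>G\<close>.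
    Combining \<open>G\<close> with its reflection makes both symmetric under conjugation and keeps
    them holomorphic.\<close>
  define re where "re G z = (G z + cnj (G (cnj z))) / 2" for G and z :: complex
  define im where "im G z = (G z - cnj (G (cnj z))) / (2 * \<i>)" for G and z :: complex
  have "\<exists>f0 f1. stem (re G) f0 \<and> stem (im G) f1" if "G holomorphic_on D" for G
  proof -
    have "cnj ` D = D" using cnj_in_iff by (auto simp: image_iff) (metis complex_cnj_cnj)
    then have c: "(\<lambda>z. cnj (G (cnj z))) holomorphic_on D"
      using holomorphic_on_compose_cnj_cnj[of G D] that open_D by (simp add: o_def)
    have "re G holomorphic_on D" "im G holomorphic_on D"
      unfolding re_def im_def using that c by (auto intro!: holomorphic_intros)
    moreover have "re G (cnj z) = cnj (re G z)" "im G (cnj z) = cnj (im G z)" for z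
      by (simp_all add: re_def im_def field_simps)
    ultimately show ?thesis by (metis exists_stem)
  qed
  then obtain f0 f1 f2 f3 where st: "stem (re A) f0" "stem (im A) f1" "stem (re B) f2" "stem (im B) f3"
    using hol by meson
  \<comment> \<open>At real points the first two terms restore \<open>A\<close> and, since
    \<open>quat_i * quat_j = quat_k\<close>, the last two restore \<open>B * quat_j\<close>.\<close>
  define g where "g x = f0 x + f1 x * quat_i + f2 x * quat_j + f3 x * quat_k" for x
  have dec: "slice_decomposition \<Omega> g (f0, f1, f2, f3)"
    using slice_decomposition_if_stem[OF st] by (simp add: g_def)
  have g: "slice_regular \<Omega> g"
    unfolding g_def using slice_preserving_if_stem[OF st(1)] slice_preserving_if_stem[OF st(2)]
      slice_preserving_if_stem[OF st(3)] slice_preserving_if_stem[OF st(4)]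
    by (intro slice_regular_add slice_regular_mult_const) (auto simp: slice_preserving_def)
  have split: "emb quat_i (re G z) + emb quat_i (im G z) * quat_i = emb quat_i (G z)" for G z
  proof -
    have "emb quat_i (re G z) + emb quat_i (im G z) * quat_i = emb quat_i (re G z + im G z * \<i>)"
      by (simp add: emb_add emb_mult emb_imaginary_unit)
    also have "re G z + im G z * \<i> = G z" by (simp add: re_def im_def field_simps)
    finally show ?thesis .
  qed
  have eq: "f x = g x" if "x \<in> \<Omega>" for x
  proof (rule slice_regular_eq_of_real[OF f g _ that])
    fix a assume "of_real a \<in> \<Omega>"
    then have z: "of_real a \<in> D" by (simp add: of_real_in_iff)
    have "g (emb quat_i (of_real a)) =
      (emb quat_i (re A (of_real a)) + emb quat_i (im A (of_real a)) * quat_i) +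
      (emb quat_i (re B (of_real a)) + emb quat_i (im B (of_real a)) * quat_i) * quat_j"
      unfolding g_def using st[THEN stem_emb, OF imag_units_basis(1) z]
      by (simp add: distrib_right mult.assoc quat_i_times_j add.assoc)
    also have "\<dots> = f (emb quat_i (of_real a))"
      unfolding split AB ..
    finally show "f (of_real a) = g (of_real a)" by simp
  qed
  have "slice_decomposition \<Omega> f (f0, f1, f2, f3)"
    using dec eq unfolding slice_decomposition_def by simp
  then show ?thesis by blast
qed

text \<open>At real points slice preserving functions have real values, so the components are there
  the four coordinates of \<open>f\<close>. The identity principle spreads the agreement over
  \<Omega>.\<close>

lemma slice_decomposition_unique:
  assumes c: "slice_decomposition \<Omega> f (f0, f1, f2, f3)"
    and c': "slice_decomposition \<Omega> f (g0, g1, g2, g3)"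
    and x: "x \<in> \<Omega>"
  shows "f0 x = g0 x \<and> f1 x = g1 x \<and> f2 x = g2 x \<and> f3 x = g3 x"
proof -
  have real: "h (of_real a) = of_real (qRe (h (of_real a)))"
    if h: "slice_preserving \<Omega> h" and a: "of_real a \<in> \<Omega>" for h a
  proof -
    obtain H where st: "stem H h" using stem_if_slice_preserving[OF h] .
    have z: "of_real a \<in> D" using a of_real_in_iff by blast
    have "cnj (H (of_real a)) = H (of_real a)" using stem_cnj[OF st z] by simp
    then have "Im (H (of_real a)) = 0" by (simp add: complex_eq_iff)
    moreover have "h (of_real a) = emb quat_i (H (of_real a))"
      using stem_emb[OF st imag_units_basis(1) z] by simp
    ultimately show ?thesis by (simp add: quat_eq_iff emb_sel)
  qed
  have sp: "slice_preserving \<Omega> h" if "h \<in> {f0, f1, f2, f3, g0, g1, g2, g3}" for h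
    using that c c' unfolding slice_decomposition_def by auto
  have at_real: "f0 (of_real a) = g0 (of_real a) \<and> f1 (of_real a) = g1 (of_real a) \<and>
      f2 (of_real a) = g2 (of_real a) \<and> f3 (of_real a) = g3 (of_real a)" if a: "of_real a \<in> \<Omega>" for a
  proof -
    let ?x = "of_real a :: quat"
    have "f0 ?x + f1 ?x * quat_i + f2 ?x * quat_j + f3 ?x * quat_k =
      g0 ?x + g1 ?x * quat_i + g2 ?x * quat_j + g3 ?x * quat_k"
      using c c' a unfolding slice_decomposition_def by auto
    moreover have im: "qIm1 (h ?x) = 0 \<and> qIm2 (h ?x) = 0 \<and> qIm3 (h ?x) = 0"
      if "h \<in> {f0, f1, f2, f3, g0, g1, g2, g3}" for h
      using real[OF sp[OF that] a] by (metis quat_of_real_sel(2-4))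
    ultimately show ?thesis
      using im[of f0] im[of f1] im[of f2] im[of f3] im[of g0] im[of g1] im[of g2] im[of g3]
      unfolding quat_eq_iff by simp
  qed
  have reg: "slice_regular \<Omega> h" if "h \<in> {f0, f1, f2, f3, g0, g1, g2, g3}" for h
    using sp[OF that] by (simp add: slice_preserving_def)
  have "f0 x = g0 x" "f1 x = g1 x" "f2 x = g2 x" "f3 x = g3 x"
    by (rule slice_regular_eq_of_real[OF reg reg _ x]; use at_real in blast)+
  then show ?thesis by blast
qed

lemma stem_of_real: "stem (\<lambda>_. of_real a) (\<lambda>_. of_real a)"
  by (simp add: stem_def)

lemma stem_add:
  assumes "stem F f" "stem G g"
  shows "stem (\<lambda>z. F z + G z) (\<lambda>x. f x + g x)"
  using assms by (auto simp: stem_def emb_add intro!: holomorphic_intros)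

lemma stem_diff:
  assumes "stem F f" "stem G g"
  shows "stem (\<lambda>z. F z - G z) (\<lambda>x. f x - g x)"
  using assms by (auto simp: stem_def emb_diff intro!: holomorphic_intros)

lemma stem_mult:
  assumes "stem F f" "stem G g"
  shows "stem (\<lambda>z. F z * G z) (\<lambda>x. f x * g x)"
  using assms by (auto simp: stem_def emb_mult intro!: holomorphic_intros)

lemma stem_cong:
  assumes "stem F f" "\<And>z. z \<in> D \<Longrightarrow> F z = G z" "\<And>x. x \<in> \<Omega> \<Longrightarrow> f x = g x"
  shows "stem G g"
  unfolding stem_def
proof (intro conjI ballI)
  show "G holomorphic_on D"
    using stem_holomorphic[OF assms(1)] assms(2) by (rule holomorphic_transform)
  show "G (cnj z) = cnj (G z)" if "z \<in> D" for z
    using stem_cnj[OF assms(1) that] assms(2) that cnj_in_iff by simp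
  show "g (emb J z) = emb J (G z)" if "J \<in> imag_units" "z \<in> D" for J z
    using stem_emb[OF assms(1) that] assms(2,3) that emb_in_iff by metis
qed

lemma slice_decomposition_components:
  assumes "slice_decomposition \<Omega> f c"
  shows "slice_decomposition \<Omega> f (slice_components \<Omega> f)"
  unfolding slice_components_def using assms by (rule someI)

end

section \<open>Powers\<close>

text \<open>The pair \<open>(p, r)\<close> with \<open>p + r w = (x + w)\<^sup>n\<close> for every \<open>w\<close> such that \<open>w\<^sup>2 = - s\<close>.\<close>

primrec pow_coeffs :: "nat \<Rightarrow> complex \<Rightarrow> complex \<Rightarrow> complex \<times> complex" where
  "pow_coeffs 0 x s = (1, 0)"
| "pow_coeffs (Suc n) x s = (case pow_coeffs n x s of (p, r) \<Rightarrow> (x * p - s * r, x * r + p))"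

definition pow_re :: "nat \<Rightarrow> complex \<Rightarrow> complex \<Rightarrow> complex" where
  "pow_re n x s = fst (pow_coeffs n x s)"

definition pow_im :: "nat \<Rightarrow> complex \<Rightarrow> complex \<Rightarrow> complex" where
  "pow_im n x s = snd (pow_coeffs n x s)"

lemma pow_re_im_simps [simp]:
  "pow_re 0 x s = 1" "pow_im 0 x s = 0"
  "pow_re (Suc n) x s = x * pow_re n x s - s * pow_im n x s"
  "pow_im (Suc n) x s = x * pow_im n x s + pow_re n x s"
  by (simp_all add: pow_re_def pow_im_def case_prod_beta)

lemma pow_re_im_eq_power:
  assumes "w\<^sup>2 = - s"
  shows "pow_re n x s + pow_im n x s * w = (x + w) ^ n"
proof (induction n)
  case (Suc n)
  have "w * w = - s" using assms by (simp add: power2_eq_square)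
  then have "pow_re (Suc n) x s + pow_im (Suc n) x s * w = (x + w) * (pow_re n x s + pow_im n x s * w)"
    by simp algebra
  then show ?case using Suc by simp
qed simp

text \<open>Both \<open>\<i> * y\<close> and its negative are admissible values of \<open>w\<close>;
  subtracting the two expansions cancels the first coefficient.\<close>

lemma pow_im_eq_power_diff:
  assumes "y\<^sup>2 = s"
  shows "2 * \<i> * y * pow_im n x s = (x + \<i> * y) ^ n - (x - \<i> * y) ^ n"
  using pow_re_im_eq_power[of "\<i> * y" s n x] pow_re_im_eq_power[of "- (\<i> * y)" s n x] assms
  by (simp add: power_mult_distrib algebra_simps)

text \<open>For \<open>s = 0\<close> the only \<open>w\<close> is 0, and the expansion says nothing
  about the second coefficient. The recursion then computes as in the dual numbers and yields the
  derivative of the power.\<close>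

lemma pow_re_im_0: "pow_re n x 0 = x ^ n \<and> pow_im n x 0 = of_nat n * x ^ (n - 1)"
proof (induction n)
  case (Suc n)
  then show ?case by (cases n) (simp_all add: algebra_simps)
qed simp

lemma pow_re_im_holomorphic:
  assumes "F holomorphic_on A" "S holomorphic_on A"
  shows "(\<lambda>z. pow_re n (F z) (S z)) holomorphic_on A \<and> (\<lambda>z. pow_im n (F z) (S z)) holomorphic_on A"
  by (induction n) (auto intro!: holomorphic_intros assms)

section \<open>The polynomials Q_d and roots of unity\<close>

lemma Im_imaginary_unit_power_odd: "Im (\<i> ^ (2 * n + 1)) = (-1) ^ n"
  by (induction n) simp_all

text \<open>In the binomial expansion only the odd powers of \<i> have an imaginary part, and their
  signs alternate as in \<open>Q_poly\<close>.\<close>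

lemma Q_poly_eq_Im:
  assumes "d \<ge> 1"
  shows "Q_poly d \<xi> 1 = Im ((of_real \<xi> + \<i>) ^ d)"
proof -
  define c where "c k = real (d choose k) * \<xi> ^ (d - k) * Im (\<i> ^ k)" for k
  \<comment> \<open>For positive \<open>d\<close> the bound \<open>(d - 1) div 2\<close> belongs to
    the last odd number not exceeding \<open>d\<close>. At \<open>d = 0\<close> truncated
    subtraction would still leave the index 1.\<close>
  have img: "(\<lambda>n. 2 * n + 1) ` {0..(d - 1) div 2} = {k. k \<le> d \<and> odd k}"
    using assms by (auto simp: image_iff elim!: oddE)
  have even: "Im (\<i> ^ k) = 0" if k: "even k" for k
  proof -
    obtain m where "k = 2 * m" using k by (rule evenE)
    then have "\<i> ^ k = of_real ((-1) ^ m)" by (simp add: power_mult)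
    then show ?thesis by simp
  qed
  have "Im ((of_real \<xi> + \<i>) ^ d) = Im ((\<i> + of_real \<xi>) ^ d)" by (simp add: add.commute)
  also have "\<dots> = (\<Sum>k\<le>d. Im (of_nat (d choose k) * \<i> ^ k * of_real \<xi> ^ (d - k)))"
    by (simp only: binomial_ring Im_sum)
  also have "\<dots> = (\<Sum>k\<le>d. c k)"
  proof (rule sum.cong)
    fix k
    have "of_nat (d choose k) * \<i> ^ k * of_real \<xi> ^ (d - k)
        = of_real (real (d choose k) * \<xi> ^ (d - k)) * \<i> ^ k"
      by simp
    then show "Im (of_nat (d choose k) * \<i> ^ k * of_real \<xi> ^ (d - k)) = c k"
      by (simp only: c_def Im_complex_of_real times_complex.sel Re_complex_of_real)
  qed simp
  also have "\<dots> = (\<Sum>k\<in>{k. k \<le> d \<and> odd k}. c k)"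
    by (rule sum.mono_neutral_right) (auto simp: c_def even)
  also have "\<dots> = (\<Sum>n = 0..(d - 1) div 2. c (2 * n + 1))"
    unfolding img[symmetric] by (subst sum.reindex) (auto simp: inj_on_def)
  also have "\<dots> = Q_poly d \<xi> 1"
    unfolding Q_poly_def c_def Im_imaginary_unit_power_odd by (simp add: mult_ac)
  finally show ?thesis ..
qed

lemma power_diff_eq_Q_poly:
  assumes "d \<ge> 1"
  shows "(of_real \<xi> + \<i>) ^ d - (of_real \<xi> - \<i>) ^ d = 2 * \<i> * of_real (Q_poly d \<xi> 1)"
proof -
  have "(of_real \<xi> - \<i>) ^ d = cnj ((of_real \<xi> + \<i>) ^ d)" by simp
  then show ?thesis unfolding Q_poly_eq_Im[OF assms] by (simp only: complex_diff_cnj) simp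
qed

text \<open>The Cayley transform is injective and sends the roots to \<open>d\<close>-th roots of
  unity, of which there are finitely many.\<close>

lemma finite_roots_Q_poly:
  assumes "d \<ge> 1"
  shows "finite {\<xi>. Q_poly d \<xi> 1 = 0}"
proof (rule finite_imageD)
  let ?h = "\<lambda>\<xi>. (of_real \<xi> + \<i>) / (of_real \<xi> - \<i>)"
  have ne: "of_real \<xi> - \<i> \<noteq> 0" for \<xi> :: real by (simp add: complex_eq_iff)
  have "?h ` {\<xi>. Q_poly d \<xi> 1 = 0} \<subseteq> {w. w ^ d = 1}"
  proof clarify
    fix \<xi> assume "Q_poly d \<xi> 1 = 0"
    then have "(complex_of_real \<xi> + \<i>) ^ d = (of_real \<xi> - \<i>) ^ d"
      using power_diff_eq_Q_poly[OF assms, of \<xi>] by simp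
    then show "?h \<xi> ^ d = 1" using ne[of \<xi>] by (simp add: power_divide)
  qed
  then show "finite (?h ` {\<xi>. Q_poly d \<xi> 1 = 0})"
    using finite_roots_unity[OF assms] finite_subset by blast
  show "inj_on ?h {\<xi>. Q_poly d \<xi> 1 = 0}"
  proof (rule inj_onI)
    fix a b :: real assume "?h a = ?h b"
    then have "(of_real a + \<i>) * (of_real b - \<i>) = (of_real b + \<i>) * (of_real a - \<i>)"
      using ne by (simp add: frac_eq_eq)
    then show "a = b" by (simp add: complex_eq_iff)
  qed
qed

text \<open>Taking norms shows that \<open>t\<close> is equidistant from \<i> and its negative,
  hence real.\<close>

lemma power_eq_imp_real_root:
  assumes "d \<ge> 1" and eq: "(t + \<i>) ^ d = (t - \<i>) ^ d"
  obtains \<xi> where "t = of_real \<xi>" "Q_poly d \<xi> 1 = 0"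
proof -
  have "norm (t + \<i>) ^ d = norm (t - \<i>) ^ d" using arg_cong[OF eq, of norm] by (simp add: norm_power)
  then have "norm (t + \<i>) = norm (t - \<i>)" using assms(1) by (simp add: power_eq_iff_eq_base)
  then have "(Re t)\<^sup>2 + (Im t + 1)\<^sup>2 = (Re t)\<^sup>2 + (Im t - 1)\<^sup>2" by (simp add: cmod_def)
  then have "Im t = 0" by (simp add: power2_eq_square algebra_simps)
  then have t: "t = of_real (Re t)" by (simp add: complex_eq_iff)
  moreover have "Q_poly d (Re t) 1 = 0"
    using power_diff_eq_Q_poly[OF assms(1), of "Re t"] eq t by simp
  ultimately show ?thesis using that by blast
qed

text \<open>Division by a square root \<open>y\<close> of \<open>s\<close>, nonzero by assumption,
  turns the homogeneous equation into the one for \<open>t = x / y\<close>.\<close>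

lemma pow_im_eq_0D:
  assumes "d \<ge> 1" "s \<noteq> 0" "pow_im d x s = 0"
  obtains \<xi> where "Q_poly d \<xi> 1 = 0" "x\<^sup>2 = (of_real \<xi>)\<^sup>2 * s"
proof -
  define y where "y = csqrt s"
  have y: "y\<^sup>2 = s" "y \<noteq> 0" using assms(2) by (auto simp: y_def)
  have "(x + \<i> * y) ^ d = (x - \<i> * y) ^ d"
    using pow_im_eq_power_diff[OF y(1), of d x] assms(3) by simp
  moreover have "x + \<i> * y = (x / y + \<i>) * y" "x - \<i> * y = (x / y - \<i>) * y"
    using y(2) by (simp_all add: field_simps)
  ultimately have "(x / y + \<i>) ^ d = (x / y - \<i>) ^ d"
    using y(2) by (simp add: power_mult_distrib)
  then obtain \<xi> where \<xi>: "x / y = of_real \<xi>" "Q_poly d \<xi> 1 = 0"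
    using power_eq_imp_real_root[OF assms(1)] by blast
  then have "x = of_real \<xi> * y" using y(2) by (simp add: field_simps)
  then have "x\<^sup>2 = (of_real \<xi>)\<^sup>2 * s" using y(1) by (simp add: power_mult_distrib)
  then show ?thesis using that \<xi>(2) by blast
qed

lemma pow_im_eq_0I:
  assumes "d \<ge> 2" "Q_poly d \<xi> 1 = 0" "x\<^sup>2 = (of_real \<xi>)\<^sup>2 * s"
  shows "pow_im d x s = 0"
proof (cases "s = 0")
  case True
  \<comment> \<open>Here \<open>x = 0\<close>, and the second coefficient
    \<open>d * x ^ (d - 1)\<close> vanishes because \<open>d\<close> is at least 2.\<close>
  then show ?thesis using assms pow_re_im_0[of d x] by simp
next
  case False
  have "x\<^sup>2 = (of_real \<xi> * csqrt s)\<^sup>2" using assms(3) by (simp add: power_mult_distrib)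
  then have "x = of_real \<xi> * csqrt s \<or> x = of_real \<xi> * (- csqrt s)" by (simp add: power2_eq_iff)
  \<comment> \<open>The hypothesis fixes \<open>x\<close> only up to sign; the sign is absorbed into
    the choice of the square root \<open>y\<close>.\<close>
  then obtain y where x: "x = of_real \<xi> * y" and y: "y\<^sup>2 = s"
    by (metis power2_csqrt power2_minus)
  have "x + \<i> * y = (of_real \<xi> + \<i>) * y" "x - \<i> * y = (of_real \<xi> - \<i>) * y"
    by (simp_all add: x algebra_simps)
  note lin = this
  have "2 * \<i> * y * pow_im d x s = ((of_real \<xi> + \<i>) ^ d - (of_real \<xi> - \<i>) ^ d) * y ^ d"
    unfolding pow_im_eq_power_diff[OF y] lin
    by (simp only: power_mult_distrib left_diff_distrib[of "(of_real \<xi> + \<i>) ^ d"])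
  also have "\<dots> = 0" using power_diff_eq_Q_poly[of d \<xi>] assms(1,2) by simp
  finally show ?thesis using False y by auto
qed

section \<open>The vectorial part of a star power\<close>

context slice_domain
begin

lemma pow_im_eq_0_iff:
  assumes F: "F holomorphic_on D" and S: "S holomorphic_on D"
    and F0: "\<exists>z\<in>D. F z \<noteq> 0" and d: "d \<ge> 2"
  shows "(\<forall>z\<in>D. pow_im d (F z) (S z) = 0) \<longleftrightarrow>
    (\<exists>\<xi>\<in>Sigma_roots d. \<forall>z\<in>D. (F z)\<^sup>2 = (of_real \<xi>)\<^sup>2 * S z)"
proof
  assume 0: "\<forall>z\<in>D. pow_im d (F z) (S z) = 0"
  \<comment> \<open>If \<open>S\<close> vanished identically, the second coefficient would be
    \<open>d * F z ^ (d - 1)\<close>, which is nonzero wherever \<open>F\<close> is.\<close>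
  have S0: "\<exists>z\<in>D. S z \<noteq> 0"
  proof (rule ccontr)
    assume "\<not> (\<exists>z\<in>D. S z \<noteq> 0)"
    then have "\<forall>z\<in>D. of_nat d * F z ^ (d - 1) = 0"
      using 0 pow_re_im_0[of d] by metis
    then show False using F0 d by auto
  qed
  define Z where "Z = {\<xi>. Q_poly d \<xi> 1 = 0}"
  have Z: "finite Z" unfolding Z_def using d by (intro finite_roots_Q_poly) simp
  let ?G = "\<lambda>\<xi> z. (F z)\<^sup>2 - (of_real \<xi>)\<^sup>2 * S z"
  have G: "?G \<xi> holomorphic_on D" for \<xi> :: real by (intro holomorphic_intros F S)
  \<comment> \<open>The root found at \<open>z\<close> may depend on \<open>z\<close>; the finite
    product removes this dependence, and the factor \<open>S z\<close> takes care of the points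
    where no root is obtained.\<close>
  have "(\<Prod>\<xi>\<in>Z. ?G \<xi> z) * S z = 0" if z: "z \<in> D" for z
  proof (cases "S z = 0")
    case False
    moreover have "pow_im d (F z) (S z) = 0" "d \<ge> 1" using 0 z d by simp_all
    ultimately obtain \<xi> where "Q_poly d \<xi> 1 = 0" "(F z)\<^sup>2 = (of_real \<xi>)\<^sup>2 * S z"
      using pow_im_eq_0D by blast
    then have "\<exists>\<xi>\<in>Z. ?G \<xi> z = 0" by (auto simp: Z_def)
    then show ?thesis using Z by simp
  qed simp
  moreover have "(\<lambda>z. \<Prod>\<xi>\<in>Z. ?G \<xi> z) holomorphic_on D"
    by (intro holomorphic_on_prod G)
  ultimately have "\<forall>z\<in>D. (\<Prod>\<xi>\<in>Z. ?G \<xi> z) = 0"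
    using holomorphic_mult_eq_0[of "\<lambda>z. \<Prod>\<xi>\<in>Z. ?G \<xi> z" S] S S0 by blast
  then obtain \<xi> where \<xi>: "\<xi> \<in> Z" "\<forall>z\<in>D. ?G \<xi> z = 0"
    using holomorphic_prod_eq_0[OF Z, of ?G] G by blast
  \<comment> \<open>The value 0, excluded from \<open>Sigma_roots\<close>, would force
    \<open>F\<close> to vanish identically.\<close>
  have "\<xi> \<noteq> 0" using \<xi>(2) F0 by auto
  then show "\<exists>\<xi>\<in>Sigma_roots d. \<forall>z\<in>D. (F z)\<^sup>2 = (of_real \<xi>)\<^sup>2 * S z"
    using \<xi> by (intro bexI[of _ \<xi>]) (auto simp: Sigma_roots_def Z_def)
next
  assume "\<exists>\<xi>\<in>Sigma_roots d. \<forall>z\<in>D. (F z)\<^sup>2 = (of_real \<xi>)\<^sup>2 * S z"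
  then show "\<forall>z\<in>D. pow_im d (F z) (S z) = 0"
    using pow_im_eq_0I[OF d] by (auto simp: Sigma_roots_def)
qed

text \<open>Inductively the vectorial part of the star power is a multiple of that of
  \<open>f\<close>. The cross product of parallel vectors vanishes, so one more star factor
  reproduces the recursion of \<open>pow_coeffs\<close>.\<close>

lemma star_power_decomposition:
  assumes comp: "slice_components \<Omega> f = (f0, f1, f2, f3)"
    and st: "stem F0 f0" "stem F1 f1" "stem F2 f2" "stem F3 f3"
    and S: "S = (\<lambda>z. (F1 z)\<^sup>2 + (F2 z)\<^sup>2 + (F3 z)\<^sup>2)"
  shows "\<exists>p r1 r2 r3. slice_decomposition \<Omega> (star_power \<Omega> f n) (p, r1, r2, r3) \<and>
    stem (\<lambda>z. pow_re n (F0 z) (S z)) p \<and>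
    stem (\<lambda>z. pow_im n (F0 z) (S z) * F1 z) r1 \<and>
    stem (\<lambda>z. pow_im n (F0 z) (S z) * F2 z) r2 \<and>
    stem (\<lambda>z. pow_im n (F0 z) (S z) * F3 z) r3"
proof (induction n)
  case 0
  have "stem (\<lambda>_. 1) (\<lambda>_. 1)" "stem (\<lambda>_. 0) (\<lambda>_. 0)"
    using stem_of_real[of 1] stem_of_real[of 0] by simp_all
  then show ?case
    by (intro exI[of _ "\<lambda>_. 1"] exI[of _ "\<lambda>_. 0"]) (auto intro: slice_decomposition_if_stem)
next
  case (Suc n)
  let ?g = "star_power \<Omega> f n"
  let ?P = "\<lambda>z. pow_re n (F0 z) (S z)" and ?R = "\<lambda>z. pow_im n (F0 z) (S z)"
  obtain p r1 r2 r3 where dec: "slice_decomposition \<Omega> ?g (p, r1, r2, r3)"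
    and p: "stem ?P p" and r: "stem (\<lambda>z. ?R z * F1 z) r1" "stem (\<lambda>z. ?R z * F2 z) r2"
      "stem (\<lambda>z. ?R z * F3 z) r3"
    using Suc by blast
  obtain g0 g1 g2 g3 where g: "slice_components \<Omega> ?g = (g0, g1, g2, g3)"
    by (metis prod_cases4)
  \<comment> \<open>The components picked by \<open>SOME\<close> need to match the constructed ones
    only on \<Omega>, which uniqueness provides.\<close>
  have eq: "g0 x = p x \<and> g1 x = r1 x \<and> g2 x = r2 x \<and> g3 x = r3 x" if "x \<in> \<Omega>" for x
    using slice_decomposition_unique[OF slice_decomposition_components[OF dec, unfolded g] dec that] .
  define q where "q x = f0 x * p x - f1 x * r1 x - f2 x * r2 x - f3 x * r3 x" for x
  define s where "s h k x = f0 x * k x + p x * h x" for h k :: "quat \<Rightarrow> quat" and x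
  have "stem (\<lambda>z. F0 z * ?P z - F1 z * (?R z * F1 z) - F2 z * (?R z * F2 z) - F3 z * (?R z * F3 z)) q"
    unfolding q_def by (intro stem_diff stem_mult st p r)
  then have q: "stem (\<lambda>z. pow_re (Suc n) (F0 z) (S z)) q"
    by (rule stem_cong) (simp_all add: S power2_eq_square algebra_simps)
  have s: "stem (\<lambda>z. pow_im (Suc n) (F0 z) (S z) * H z) (s h k)"
    if "stem H h" "stem (\<lambda>z. ?R z * H z) k" for H h k
  proof -
    have "stem (\<lambda>z. F0 z * (?R z * H z) + ?P z * H z) (s h k)"
      unfolding s_def by (intro stem_add stem_mult st p that)
    then show ?thesis by (rule stem_cong) (simp_all add: algebra_simps)
  qed
  \<comment> \<open>At a given point all slice preserving functions take values in one common slice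
    and therefore commute, so the cross product can be computed with stems.\<close>
  have cross: "h x * l x = m x * k x"
    if hs: "stem H h" "stem M m" "stem (\<lambda>z. ?R z * H z) k" "stem (\<lambda>z. ?R z * M z) l"
      and x: "x \<in> \<Omega>"
    for H M h m k l x
  proof -
    obtain J z where J: "J \<in> imag_units" and z: "z \<in> D" "x = emb J z"
      using exists_emb_in[OF x] .
    have "h x * l x = emb J (H z * (?R z * M z))" "m x * k x = emb J (M z * (?R z * H z))"
      unfolding z(2) emb_mult[OF J] using hs[THEN stem_emb, OF J z(1)]
      by (simp_all add: emb_mult[OF J])
    then show ?thesis by (simp add: mult_ac)
  qed
  have "star_power \<Omega> f (Suc n) x =
      q x + s f1 r1 x * quat_i + s f2 r2 x * quat_j + s f3 r3 x * quat_k" if x: "x \<in> \<Omega>" for x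
  proof -
    have "f2 x * r3 x = f3 x * r2 x" "f3 x * r1 x = f1 x * r3 x" "f1 x * r2 x = f2 x * r1 x"
      using cross st r x by blast+
    then show ?thesis
      using eq[OF x] by (simp add: star_prod_def comp g q_def s_def distrib_left distrib_right mult.assoc)
  qed
  then have "slice_decomposition \<Omega> (star_power \<Omega> f (Suc n)) (q, s f1 r1, s f2 r2, s f3 r3)"
    by (intro slice_decomposition_if_stem[OF q s[OF st(2) r(1)] s[OF st(3) r(2)] s[OF st(4) r(3)]])
  then show ?case using q s[OF st(2) r(1)] s[OF st(3) r(2)] s[OF st(4) r(3)] by blast
qed

text \<open>A slice preserving star power, followed by three zeros, is a second decomposition of
  itself. Uniqueness then kills the second coefficient times each of \<open>F1\<close>,
  \<open>F2\<close>, \<open>F3\<close>, one of which is not identically zero. Conversely, if that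
  coefficient vanishes, only the real part remains.\<close>

lemma slice_preserving_star_power_iff:
  assumes comp: "slice_components \<Omega> f = (f0, f1, f2, f3)"
    and st: "stem F0 f0" "stem F1 f1" "stem F2 f2" "stem F3 f3"
    and S: "S = (\<lambda>z. (F1 z)\<^sup>2 + (F2 z)\<^sup>2 + (F3 z)\<^sup>2)"
    and ne: "\<exists>z\<in>D. F1 z \<noteq> 0 \<or> F2 z \<noteq> 0 \<or> F3 z \<noteq> 0"
  shows "slice_preserving \<Omega> (star_power \<Omega> f n) \<longleftrightarrow> (\<forall>z\<in>D. pow_im n (F0 z) (S z) = 0)"
proof -
  let ?R = "\<lambda>z. pow_im n (F0 z) (S z)"
  obtain p r1 r2 r3 where dec: "slice_decomposition \<Omega> (star_power \<Omega> f n) (p, r1, r2, r3)"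
    and p: "stem (\<lambda>z. pow_re n (F0 z) (S z)) p"
    and r: "stem (\<lambda>z. ?R z * F1 z) r1" "stem (\<lambda>z. ?R z * F2 z) r2" "stem (\<lambda>z. ?R z * F3 z) r3"
    using star_power_decomposition[OF comp st S, of n] by blast
  show ?thesis
  proof
    assume "slice_preserving \<Omega> (star_power \<Omega> f n)"
    moreover have "slice_preserving \<Omega> (\<lambda>_. 0)"
      using slice_preserving_if_stem[OF stem_of_real[of 0]] by simp
    ultimately have dec': "slice_decomposition \<Omega> (star_power \<Omega> f n)
        (star_power \<Omega> f n, \<lambda>_. 0, \<lambda>_. 0, \<lambda>_. 0)"
      by (simp add: slice_decomposition_def)
    have R0: "?R z * F1 z = 0 \<and> ?R z * F2 z = 0 \<and> ?R z * F3 z = 0" if z: "z \<in> D" for z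
    proof -
      have "emb quat_i z \<in> \<Omega>" using z by (simp add: D_def)
      from slice_decomposition_unique[OF dec dec' this]
      have "emb quat_i (?R z * F1 z) = emb quat_i 0" "emb quat_i (?R z * F2 z) = emb quat_i 0"
        "emb quat_i (?R z * F3 z) = emb quat_i 0"
        using r[THEN stem_emb, OF imag_units_basis(1) z] by simp_all
      then show ?thesis unfolding emb_inject[OF imag_units_basis(1)] by blast
    qed
    have "S holomorphic_on D" unfolding S by (intro holomorphic_intros st[THEN stem_holomorphic])
    then have R: "?R holomorphic_on D"
      using pow_re_im_holomorphic stem_holomorphic[OF st(1)] by blast
    show "\<forall>z\<in>D. ?R z = 0"
      using ne R0 holomorphic_mult_eq_0[OF R st(2)[THEN stem_holomorphic]]
        holomorphic_mult_eq_0[OF R st(3)[THEN stem_holomorphic]]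
        holomorphic_mult_eq_0[OF R st(4)[THEN stem_holomorphic]]
      by blast
  next
    assume R0: "\<forall>z\<in>D. ?R z = 0"
    have "star_power \<Omega> f n x = p x" if x: "x \<in> \<Omega>" for x
    proof -
      obtain J z where J: "J \<in> imag_units" and z: "z \<in> D" "x = emb J z"
        using exists_emb_in[OF x] .
      have "r1 x = 0" "r2 x = 0" "r3 x = 0"
        using r[THEN stem_emb, OF J z(1)] R0 z by simp_all
      then show ?thesis using dec x by (auto simp: slice_decomposition_def)
    qed
    then have "stem (\<lambda>z. pow_re n (F0 z) (S z)) (star_power \<Omega> f n)"
      by (intro stem_cong[OF p]) simp_all
    then show "slice_preserving \<Omega> (star_power \<Omega> f n)" by (rule slice_preserving_if_stem)
  qed
qed

end

theorem proposition7p4: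
  fixes \<Omega> :: "quat set" and f :: "quat \<Rightarrow> quat" and d :: nat
  assumes "symmetric_slice_domain \<Omega>"
    and "slice_regular \<Omega> f"
    and "preserves_no_slice \<Omega> f"
    and "\<exists>x\<in>\<Omega>. real_part \<Omega> f x \<noteq> 0"
    and "d > 2"
  shows "slice_preserving \<Omega> (star_power \<Omega> f d) \<longleftrightarrow>
    (\<exists>\<xi>\<in>Sigma_roots d. \<forall>x\<in>\<Omega>. (real_part \<Omega> f x)\<^sup>2 = \<xi>\<^sup>2 *\<^sub>R vec_symm \<Omega> f x)"
proof -
  interpret slice_domain \<Omega> by (rule slice_domain.intro) (rule assms(1))
  obtain f0 f1 f2 f3 where comp: "slice_components \<Omega> f = (f0, f1, f2, f3)"
    by (metis prod_cases4)
  \<comment> \<open>Existence of some decomposition ensures that the tuple picked by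
    \<open>SOME\<close> is one.\<close>
  have dec: "slice_decomposition \<Omega> f (f0, f1, f2, f3)"
    using exists_slice_decomposition[OF assms(2)] slice_decomposition_components comp by metis
  then have sp: "slice_preserving \<Omega> f0" "slice_preserving \<Omega> f1" "slice_preserving \<Omega> f2" "slice_preserving \<Omega> f3"
    by (auto simp: slice_decomposition_def)
  obtain F0 where st0: "stem F0 f0" using stem_if_slice_preserving[OF sp(1)] .
  obtain F1 where st1: "stem F1 f1" using stem_if_slice_preserving[OF sp(2)] .
  obtain F2 where st2: "stem F2 f2" using stem_if_slice_preserving[OF sp(3)] .
  obtain F3 where st3: "stem F3 f3" using stem_if_slice_preserving[OF sp(4)] .
  note st = st0 st1 st2 st3
  define S where "S = (\<lambda>z. (F1 z)\<^sup>2 + (F2 z)\<^sup>2 + (F3 z)\<^sup>2)"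
  have parts: "real_part \<Omega> f = f0" "vec_symm \<Omega> f = (\<lambda>x. (f1 x)\<^sup>2 + (f2 x)\<^sup>2 + (f3 x)\<^sup>2)"
    by (simp_all add: real_part_def vec_symm_def comp)
  \<comment> \<open>Without a vectorial part \<open>f\<close> would map the slice of
    \<open>quat_i\<close> into itself.\<close>
  have ne: "\<exists>z\<in>D. F1 z \<noteq> 0 \<or> F2 z \<noteq> 0 \<or> F3 z \<noteq> 0"
  proof (rule ccontr)
    assume 0: "\<not> ?thesis"
    have eq: "f (emb quat_i z) = emb quat_i (F0 z)" if z: "z \<in> D" for z
    proof -
      have "emb quat_i z \<in> \<Omega>" using z by (simp add: D_def)
      then show ?thesis
        using dec st[THEN stem_emb, OF imag_units_basis(1) z] 0 z by (auto simp: slice_decomposition_def)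
    qed
    have "f ` (\<Omega> \<inter> slice quat_i) \<subseteq> slice quat_i"
      using eq by (auto simp: slice_eq_range D_def)
    then show False
      using assms(3) imag_units_basis(1) unfolding preserves_no_slice_def by blast
  qed
  have F0: "\<exists>z\<in>D. F0 z \<noteq> 0"
  proof -
    obtain x where x: "x \<in> \<Omega>" "f0 x \<noteq> 0" using assms(4) parts by auto
    obtain J z where J: "J \<in> imag_units" and z: "z \<in> D" "x = emb J z"
      using exists_emb_in[OF x(1)] .
    then show ?thesis using x(2) stem_emb[OF st(1) J z(1)] by (intro bexI[of _ z]) auto
  qed
  have S: "S holomorphic_on D" unfolding S_def by (intro holomorphic_intros st[THEN stem_holomorphic])
  have eq_iff: "(real_part \<Omega> f (emb J z))\<^sup>2 = \<xi>\<^sup>2 *\<^sub>R vec_symm \<Omega> f (emb J z) \<longleftrightarrow>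
      (F0 z)\<^sup>2 = (of_real \<xi>)\<^sup>2 * S z" if J: "J \<in> imag_units" and z: "z \<in> D" for J z and \<xi> :: real
  proof -
    have "(real_part \<Omega> f (emb J z))\<^sup>2 = emb J ((F0 z)\<^sup>2)"
      by (simp add: parts emb_power[OF J] stem_emb[OF st(1) J z])
    moreover have "\<xi>\<^sup>2 *\<^sub>R vec_symm \<Omega> f (emb J z) = emb J ((of_real \<xi>)\<^sup>2 * S z)"
      by (simp add: parts S_def emb_mult[OF J] emb_power[OF J] emb_add st[THEN stem_emb, OF J z]
          scaleR_conv_of_real)
    ultimately show ?thesis by (simp add: emb_inject[OF J])
  qed
  \<comment> \<open>Every point of \<Omega> lies over a point of \<open>D\<close>, and the condition
    on the stems does not mention the slice, so a single condition on \<open>D\<close> decides the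
    identity on all of \<Omega>.\<close>
  have "(\<forall>x\<in>\<Omega>. (real_part \<Omega> f x)\<^sup>2 = \<xi>\<^sup>2 *\<^sub>R vec_symm \<Omega> f x) \<longleftrightarrow>
      (\<forall>z\<in>D. (F0 z)\<^sup>2 = (of_real \<xi>)\<^sup>2 * S z)" for \<xi> :: real
    using eq_iff exists_emb_in emb_in_iff imag_units_basis(1) by metis
  then show ?thesis
    using slice_preserving_star_power_iff[OF comp st S_def ne, of d]
      pow_im_eq_0_iff[OF stem_holomorphic[OF st(1)] S F0, of d] assms(5)
    by simp
qed

end
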